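(* Let $h$ be a non-constant harmonic function on $\mathcal{SG}$ and let $E$ be an $m$-edge in $\mathcal{SG}$. Then: (1) if $\frac14\le r^E(h)\le 4$, then $h|_E$ is strictly monotone; (2) otherwise (including $r^E(h)=\infty$) $h|_E$ has a single extremum. Moreover, define $$\alpha^E(h)=\lim_{l\to\infty}\frac{|h(p_1^{E_{0^l}})-h(p_0^E)|}{|p_1^{E_{0^l}}-p_0^E|},\qquad \beta^E(h)=\lim_{l\to\infty}\frac{|h(p_0^{E_{1^l}})-h(p_1^E)|}{|p_0^{E_{1^l}}-p_1^E|}.$$ Then $\alpha^E(h)=0$ when $r^E(h)=4$ and $\alpha^E(h)=\infty$ when $r^E(h)\neq 4$; and $\beta^E(h)=0$ when $r^E(h)=\frac14$ and $\beta^E(h)=\infty$ when $r^E(h)\ne\frac14$.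
   Context: Sierpinski gasket. Let $q_0,q_1,q_2$ be the vertices of an equilateral triangle in $\mathbb{R}^2$, $F_i(x)=\frac12(x-q_i)+q_i$, and let $\mathcal{SG}$ be the attractor of $\{F_0,F_1,F_2\}$, i.e. the nonempty compact set with $\mathcal{SG}=\bigcup_{i=0}^2F_i\mathcal{SG}$. For a word $w=w_1\cdots w_m$ with $w_i\in\{0,1,2\}$ put $F_w=F_{w_1}\circ\cdots\circ F_{w_m}$; $F_w\mathcal{SG}$ is called an $m$-cell, with boundary vertices $F_wq_0,F_wq_1,F_wq_2$. An $m$-edge is a line segment joining two distinct boundary vertices of an $m$-cell. Harmonic functions. A continuous function $h:\mathcal{SG}\to\mathbb{R}$ is harmonic if for every cell with boundary vertices $p_0,p_1,p_2$ one has $h(p_{ij})=\frac25h(p_i)+\frac25h(p_j)+\frac15h(p_k)$ for distinct $i,j,k\in\{0,1,2\}$, where $p_{ij}$ is the midpoint of the edge joining $p_i$ and $p_j$. (Values on $V_0=\{q_0,q_1,q_2\}$ can be freely assigned and determine $h$.) A non-constant harmonic function is non-constant on every edge. Edges. For an $m$-edge $E$, let $p_0^E,p_1^E$ be its endpoints (in a fixed order) and $p_{01}^E$ its midpoint. For a function $f$ non-constant on $E$, $$r^E(f)=\frac{f(p_1^E)-f(p_{01}^E)}{f(p_{01}^E)-f(p_0^E)}\in\mathbb{R}\cup\{\infty\},$$ where $r^E(f)=\infty$ (a single point at infinity, $+\infty$ and $-\infty$ not distinguished) when $f(p_{01}^E)=f(p_0^E)$. Let $\phi_i^E(x)=\frac12(x-p_i^E)+p_i^E$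 for $i=0,1$, and for a word $\tau=\tau_1\cdots\tau_l$ with $\tau_i\in\{0,1\}$ let $E_\tau=\phi^E_{\tau_1}\circ\cdots\circ\phi^E_{\tau_l}(E)$, an $(m+l)$-edge, with endpoints $p_i^{E_\tau}=\phi^E_{\tau_1}\circ\cdots\circ\phi^E_{\tau_l}(p_i^E)$, $i=0,1$. $0^l$ (resp. $1^l$) is the word consisting of $l$ zeros (resp. ones). "Extremum" of $f|_E$ means a local extremum of $f|_E$ at a point of $E$ other than its endpoints; "a single extremum" means exactly one. *)

theory Defs
  imports "HOL-Analysis.Analysis"
begin

text \<open>The vertices of the triangle are given by \<open>q :: nat \<Rightarrow> real^2\<close>, of which only
  \<open>q 0\<close>, \<open>q 1\<close>, \<open>q 2\<close> matter; words are lists of naturals.\<close>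

definition equilateral :: "(nat \<Rightarrow> real^2) \<Rightarrow> bool" where
  "equilateral q \<longleftrightarrow> q 0 \<noteq> q 1 \<and> dist (q 0) (q 1) = dist (q 1) (q 2) \<and> dist (q 1) (q 2) = dist (q 2) (q 0)"

definition halve :: "real^2 \<Rightarrow> real^2 \<Rightarrow> real^2" where
  "halve c x = (1/2) *\<^sub>R (x - c) + c"

text \<open>\<open>word_map q w\<close> is \<open>F\<^sub>w\<close>; for an edge with endpoints \<open>p 0\<close>, \<open>p 1\<close> and a word \<open>\<tau>\<close> over
  \<open>{0, 1}\<close>, \<open>word_map p \<tau>\<close> is \<open>\<phi>\<^sub>\<tau>\<close> (first letter outermost).\<close>

definition word_map :: "(nat \<Rightarrow> real^2) \<Rightarrow> nat list \<Rightarrow> real^2 \<Rightarrow> real^2" where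
  "word_map c w = foldr (\<lambda>i. halve (c i)) w"

definition is_attractor :: "(nat \<Rightarrow> real^2) \<Rightarrow> (real^2) set \<Rightarrow> bool" where
  "is_attractor q K \<longleftrightarrow> compact K \<and> K \<noteq> {} \<and> K = (\<Union>i\<in>{0,1,2}. halve (q i) ` K)"

definition SG :: "(nat \<Rightarrow> real^2) \<Rightarrow> (real^2) set" where
  "SG q = (THE K. is_attractor q K)"

lemma dist_halve: "dist (halve c x) (halve c y) = dist x y / 2"
proof -
  have "halve c x - halve c y = (1/2) *\<^sub>R (x - y)"
    by (simp add: halve_def algebra_simps)
  then show ?thesis by (simp add: dist_norm)
qed

lemma continuous_on_halve: "continuous_on A (halve c)"
  unfolding halve_def by (intro continuous_intros)

lemma word_map_simps [simp]:
  "word_map c [] x = x" "word_map c (i # w) x = halve (c i) (word_map c w x)"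
  by (simp_all add: word_map_def)

lemma dist_word_map: "dist (word_map c w x) (word_map c w y) = dist x y / 2 ^ length w"
  by (induction w) (auto simp: dist_halve field_simps)

lemma is_attractor_iff:
  assumes "is_attractor q K"
  shows "x \<in> K \<longleftrightarrow> (\<exists>i\<in>{0,1,2}. \<exists>y\<in>K. x = halve (q i) y)"
proof -
  have "K = (\<Union>i\<in>{0,1,2}. halve (q i) ` K)"
    using assms unfolding is_attractor_def by (elim conjE)
  then have "x \<in> K \<longleftrightarrow> x \<in> (\<Union>i\<in>{0,1,2}. halve (q i) ` K)"
    by (rule arg_cong[where f = "\<lambda>A. x \<in> A"])
  then show ?thesis by (simp only: UN_iff image_iff)
qed

lemma is_attractor_step:
  assumes "is_attractor q K" "i \<in> {0,1,2}" "y \<in> K"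
  shows "halve (q i) y \<in> K"
  unfolding is_attractor_iff[OF assms(1), of "halve (q i) y"]
  using assms(2,3) by (intro bexI[of _ i] bexI[of _ y] refl)

lemma is_attractor_cover:
  assumes "is_attractor q K" "x \<in> K"
  obtains i y where "i \<in> {0,1,2}" "y \<in> K" "x = halve (q i) y"
  using assms(2) that unfolding is_attractor_iff[OF assms(1), of x] by (elim bexE)

lemma is_attractor_vertex_mem:
  assumes "is_attractor q K" "i \<in> {0,1,2}"
  shows "q i \<in> K"
proof -
  obtain x where x: "x \<in> K" using assms unfolding is_attractor_def by (metis ex_in_conv)
  have step: "halve (q i) y \<in> K" if "y \<in> K" for y
    using is_attractor_step[OF assms(1) assms(2) that] .
  have mem: "word_map q (replicate n i) x \<in> K" for n
    by (induction n) (auto simp: x step)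
  have "word_map q (replicate n i) (q i) = q i" for n
    by (induction n) (auto simp: halve_def)
  then have "dist (word_map q (replicate n i) x) (q i) = dist x (q i) / 2 ^ n" for n
    using dist_word_map[of q "replicate n i" x "q i"] by simp
  moreover have "(\<lambda>n. dist x (q i) / 2 ^ n) \<longlonglongrightarrow> 0"
    by (rule LIMSEQ_divide_realpow_zero) simp
  ultimately have lim: "(\<lambda>n. word_map q (replicate n i) x) \<longlonglongrightarrow> q i"
    by (subst tendsto_dist_iff) simp
  have "closed K" using assms unfolding is_attractor_def by (metis compact_imp_closed)
  then show ?thesis using mem lim by (rule closed_sequentially)
qed

lemma is_attractor_eq_closure:
  assumes "is_attractor q K"
  shows "K = closure {word_map q w (q 0) | w. set w \<subseteq> {0,1,2}}" (is "K = closure ?S")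
proof
  have step: "halve (q i) y \<in> K" if "y \<in> K" "i \<in> {0,1,2}" for y i
    using is_attractor_step[OF assms that(2,1)] .
  have mem: "word_map q w (q 0) \<in> K" if "set w \<subseteq> {0,1,2}" for w
    using that by (induction w) (auto simp: is_attractor_vertex_mem[OF assms] intro!: step)
  have "closed K" using assms unfolding is_attractor_def by (metis compact_imp_closed)
  then show "closure ?S \<subseteq> K" using mem by (intro closure_minimal) auto
  obtain B where B: "\<And>x y. x \<in> K \<Longrightarrow> y \<in> K \<Longrightarrow> dist x y \<le> B"
    using assms unfolding is_attractor_def
    by (meson compact_imp_bounded diameter_bounded_bound)
  have addr: "\<exists>w y. set w \<subseteq> {0,1,2} \<and> length w = n \<and> y \<in> K \<and> x = word_map q w y"
    if "x \<in> K" for x n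
    using that
  proof (induction n arbitrary: x)
    case 0
    then show ?case by (intro exI[of _ "[]"] exI[of _ x]) auto
  next
    case (Suc n)
    obtain i z where iz: "i \<in> {0,1,2}" "z \<in> K" "x = halve (q i) z"
      by (rule is_attractor_cover[OF assms Suc.prems])
    obtain w y where "set w \<subseteq> {0,1,2}" "length w = n" "y \<in> K" "z = word_map q w y"
      using Suc.IH[OF iz(2)] by blast
    then show ?case using iz by (intro exI[of _ "i # w"] exI[of _ y]) auto
  qed
  show "K \<subseteq> closure ?S"
  proof
    fix x assume x: "x \<in> K"
    show "x \<in> closure ?S"
      unfolding closure_approachable
    proof (intro allI impI)
      fix e :: real assume e: "e > 0"
      have "(\<lambda>n. B / 2 ^ n) \<longlonglongrightarrow> 0"
        by (rule LIMSEQ_divide_realpow_zero) simp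
      from order_tendstoD(2)[OF this e] obtain n where n: "B / 2 ^ n < e"
        by (auto simp: eventually_sequentially)
      obtain w y where w: "set w \<subseteq> {0,1,2}" "length w = n" "y \<in> K" "x = word_map q w y"
        using addr[OF x] by blast
      have "dist (word_map q w (q 0)) x \<le> B / 2 ^ n"
        using B[OF is_attractor_vertex_mem[OF assms, of 0] w(3)] w
        by (simp add: dist_word_map divide_right_mono)
      then show "\<exists>y\<in>?S. dist y x < e" using w n by force
    qed
  qed
qed

lemma is_attractor_closure:
  "is_attractor q (closure {word_map q w (q 0) | w. set w \<subseteq> {0,1,2}})" (is "is_attractor q (closure ?S)")
proof -
  define R where "R = Max (norm ` q ` {0,1,2})"
  have R: "norm (q i) \<le> R" if "i \<in> {0,1,2}" for i
    unfolding R_def using that by (intro Max_ge) auto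
  have hv: "norm (halve (q i) x) \<le> R" if "i \<in> {0,1,2}" "norm x \<le> R" for i x
  proof -
    have "halve (q i) x = (1/2) *\<^sub>R (x + q i)"
      by (simp add: halve_def vec_eq_iff field_simps)
    then show ?thesis using norm_triangle_ineq[of x "q i"] R[OF that(1)] that(2) by simp
  qed
  have "norm (word_map q w (q 0)) \<le> R" if "set w \<subseteq> {0,1,2}" for w
    using that by (induction w) (auto simp: R intro!: hv)
  then have "bounded ?S" by (auto simp: bounded_iff)
  then have comp: "compact (closure ?S)" by (simp add: compact_closure)
  have ne: "q 0 \<in> ?S" by (auto intro!: exI[of _ "[]"])
  have sub: "halve (q i) ` ?S \<subseteq> ?S" if "i \<in> {0,1,2}" for i
  proof
    fix x assume "x \<in> halve (q i) ` ?S"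
    then obtain w where "set w \<subseteq> {0,1,2}" "x = word_map q (i # w) (q 0)" by auto
    moreover from this that have "set (i # w) \<subseteq> {0,1,2}" by auto
    ultimately show "x \<in> ?S" by blast
  qed
  have cov: "?S \<subseteq> (\<Union>i\<in>{0,1,2}. halve (q i) ` ?S)"
  proof
    fix x assume "x \<in> ?S"
    then obtain w where w: "set w \<subseteq> {0,1,2}" "x = word_map q w (q 0)" by auto
    show "x \<in> (\<Union>i\<in>{0,1,2}. halve (q i) ` ?S)"
    proof (cases w)
      case Nil
      then have "x = halve (q 0) (q 0)" using w by (simp add: halve_def)
      then show ?thesis using ne by (intro UN_I[of 0] image_eqI) simp_all
    next
      case (Cons i v)
      then have "i \<in> {0,1,2}" "word_map q v (q 0) \<in> ?S" "x = halve (q i) (word_map q v (q 0))"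
        using w by auto
      then show ?thesis by (intro UN_I image_eqI)
    qed
  qed
  have 1: "(\<Union>i\<in>{0,1,2}. halve (q i) ` closure ?S) \<subseteq> closure ?S"
  proof (rule UN_least)
    fix i :: nat assume i: "i \<in> {0,1,2}"
    show "halve (q i) ` closure ?S \<subseteq> closure ?S"
      using continuous_on_halve closed_closure subset_trans[OF sub[OF i] closure_subset]
      by (rule image_closure_subset)
  qed
  have 2: "closure ?S \<subseteq> (\<Union>i\<in>{0,1,2}. halve (q i) ` closure ?S)"
  proof (rule closure_minimal)
    show "?S \<subseteq> (\<Union>i\<in>{0,1,2}. halve (q i) ` closure ?S)"
      by (rule subset_trans[OF cov]) (intro UN_mono image_mono closure_subset subset_refl)
    have cl: "closed (halve (q i) ` closure ?S)" for i
      by (rule compact_imp_closed[OF compact_continuous_image[OF continuous_on_halve comp]])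
    show "closed (\<Union>i\<in>{0,1,2}. halve (q i) ` closure ?S)"
      by (intro closed_UN ballI cl) simp
  qed
  have "closure ?S \<noteq> {}" using ne closure_subset by fast
  with comp show ?thesis
    unfolding is_attractor_def by (intro conjI equalityI[OF 2 1])
qed

lemma ex1_is_attractor: "\<exists>!K. is_attractor q K"
  by (rule ex1I, rule is_attractor_closure, erule is_attractor_eq_closure)

lemma is_attractor_SG: "is_attractor q (SG q)"
  unfolding SG_def by (rule theI'[OF ex1_is_attractor])

definition harmonic :: "(nat \<Rightarrow> real^2) \<Rightarrow> (real^2 \<Rightarrow> real) \<Rightarrow> bool" where
  "harmonic q h \<longleftrightarrow> continuous_on (SG q) h \<and>
     (\<forall>w i j k. set w \<subseteq> {0,1,2} \<longrightarrow> {i,j,k} = {0,1,2} \<longrightarrow>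
        h (midpoint (word_map q w (q i)) (word_map q w (q j))) =
          2/5 * h (word_map q w (q i)) + 2/5 * h (word_map q w (q j)) + 1/5 * h (word_map q w (q k)))"

definition is_edge :: "(nat \<Rightarrow> real^2) \<Rightarrow> nat \<Rightarrow> (real^2) set \<Rightarrow> bool" where
  "is_edge q m E \<longleftrightarrow> (\<exists>w i j. length w = m \<and> set w \<subseteq> {0,1,2} \<and> i \<in> {0,1,2} \<and> j \<in> {0,1,2} \<and> i \<noteq> j \<and>
     E = closed_segment (word_map q w (q i)) (word_map q w (q j)))"

text \<open>In what follows an edge is given by its ordered endpoints \<open>p 0\<close>, \<open>p 1\<close>. The codomain
  \<open>\<real> \<union> {\<infinity>}\<close> of the ratio is taken inside \<^typ>\<open>ereal\<close>; the value \<open>-\<infinity>\<close> never occurs, so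
  \<open>\<infinity>\<close> is the single point at infinity.\<close>

definition edge_ratio :: "(real^2 \<Rightarrow> real) \<Rightarrow> (nat \<Rightarrow> real^2) \<Rightarrow> ereal" where
  "edge_ratio f p =
     (let c = midpoint (p 0) (p 1)
      in if f c = f (p 0) then \<infinity> else ereal ((f (p 1) - f c) / (f c - f (p 0))))"

definition strictly_monotone_on_edge :: "(real^2 \<Rightarrow> real) \<Rightarrow> (nat \<Rightarrow> real^2) \<Rightarrow> bool" where
  "strictly_monotone_on_edge f p \<longleftrightarrow>
     strict_mono_on {0..1} (f \<circ> linepath (p 0) (p 1)) \<or>
     strict_antimono_on {0..1} (f \<circ> linepath (p 0) (p 1))"

definition local_extremum_on :: "(real^2) set \<Rightarrow> (real^2 \<Rightarrow> real) \<Rightarrow> real^2 \<Rightarrow> bool" where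
  "local_extremum_on E f x \<longleftrightarrow> x \<in> E \<and>
     ((\<forall>\<^sub>F y in at x within E. f y \<le> f x) \<or> (\<forall>\<^sub>F y in at x within E. f y \<ge> f x))"

definition alpha_quotient :: "(real^2 \<Rightarrow> real) \<Rightarrow> (nat \<Rightarrow> real^2) \<Rightarrow> nat \<Rightarrow> ereal" where
  "alpha_quotient f p l =
     (let x = word_map p (replicate l 0) (p 1) in ereal (\<bar>f x - f (p 0)\<bar> / norm (x - p 0)))"

definition beta_quotient :: "(real^2 \<Rightarrow> real) \<Rightarrow> (nat \<Rightarrow> real^2) \<Rightarrow> nat \<Rightarrow> ereal" where
  "beta_quotient f p l =
     (let x = word_map p (replicate l 1) (p 0) in ereal (\<bar>f x - f (p 1)\<bar> / norm (x - p 1)))"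

text \<open>\<^const>\<open>lim\<close> is only meaningful together with \<^const>\<open>convergent\<close> (in \<^typ>\<open>ereal\<close>, so
  divergence to \<open>\<infinity>\<close> counts as convergence).\<close>

definition edge_alpha :: "(real^2 \<Rightarrow> real) \<Rightarrow> (nat \<Rightarrow> real^2) \<Rightarrow> ereal" where
  "edge_alpha f p = lim (alpha_quotient f p)"

definition edge_beta :: "(real^2 \<Rightarrow> real) \<Rightarrow> (nat \<Rightarrow> real^2) \<Rightarrow> ereal" where
  "edge_beta f p = lim (beta_quotient f p)"

end

theory Submission
  imports Defs
begin

text \<open>Let \<open>a\<close>, \<open>b\<close> be the values of \<open>h\<close> at the ends of an edge and \<open>c\<close> the value at the third
  vertex of its cell. Useful coordinates for \<open>h\<close> on the edge are the two
  differences \<open>P = b + c - 2 a\<close> and \<open>Q = 2 b - a - c\<close>. Up to a constant factor and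
  orientation they are the normal derivatives of \<open>h\<close> at the two ends; in what follows they are
  called the slopes there, with positive sign if \<open>h\<close> rises in the direction of the edge. The rise along
  the edge is \<open>(P + Q) / 3\<close>, and by the rule for midpoints the slopes of the left half are
  \<open>(3 P / 5, (P + Q) / 5)\<close> and those of the right half \<open>((P + Q) / 5, 3 Q / 5)\<close>. So the
  third vertex disappears: the edge carries a self-contained system, in which the slope at a
  given end keeps its sign for ever and the slope at a new point has the sign of the rise.

  Everything follows from the signs of \<open>P\<close> and \<open>Q\<close>. They are not both zero, since \<open>P = Q = 0\<close>
  means \<open>a = b = c\<close>, and a harmonic function that is constant on the vertices of one cell is
  constant (lemma \<open>harmonic_constant_cell\<close>). If both are nonnegative, all subedges have
  nonnegative slopes and a positive rise, and the function increases (lemma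
  \<open>edge_profile_strict_mono\<close>). If \<open>P \<ge> 0 \<ge> Q\<close>, one of the halves is monotone and the other
  is again of this kind, so the function climbs to a peak and descends from it (lemma
  \<open>edge_profile_peak\<close>). The remaining signs are those of \<open>- h\<close>. At the first end the rise over
  the initial subedge of relative length \<open>2^-l\<close> is \<open>(3/5)^l P / 2 + (1/5)^l (2 Q - P) / 6\<close>;
  as \<open>3/5 > 1/2 > 1/5\<close>, the difference quotient tends to infinity if \<open>P \<noteq> 0\<close> and to zero if
  \<open>P = 0\<close> (lemma \<open>edge_profile_quotient\<close>). In particular a peak cannot sit at an end where
  the slope does not vanish.

  The ratio \<open>r\<close> of the edge is \<open>(P + 4 Q) / (4 P + Q)\<close>. Hence \<open>r = 4\<close> means \<open>P = 0\<close>, \<open>r = 1/4\<close>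
  means \<open>Q = 0\<close>, and \<open>1/4 \<le> r \<le> 4\<close> means that \<open>P\<close> and \<open>Q\<close> do not have opposite signs.\<close>

section \<open>Functions on an interval refined by the midpoint rule of an edge\<close>

text \<open>\<open>P\<close> and \<open>Q\<close> are the slopes, in the sense of normal derivatives, at \<open>0\<close> and at \<open>1\<close>. The definition is
  coinductive because the rule holds on every dyadic subinterval: the profile of a half is
  again a profile, without end.\<close>

coinductive edge_profile :: "(real \<Rightarrow> real) \<Rightarrow> real \<Rightarrow> real \<Rightarrow> bool" where
  refine: "continuous_on {0..1} f \<Longrightarrow> f 1 - f 0 = (P + Q) / 3 \<Longrightarrow>
    edge_profile (\<lambda>t. f (t / 2)) (3 / 5 * P) ((P + Q) / 5) \<Longrightarrow>
    edge_profile (\<lambda>t. f ((1 + t) / 2)) ((P + Q) / 5) (3 / 5 * Q) \<Longrightarrow>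
    edge_profile f P Q"

lemma edge_profileD:
  assumes "edge_profile f P Q"
  shows "continuous_on {0..1} f" "f 1 - f 0 = (P + Q) / 3"
    "edge_profile (\<lambda>t. f (t / 2)) (3 / 5 * P) ((P + Q) / 5)"
    "edge_profile (\<lambda>t. f ((1 + t) / 2)) ((P + Q) / 5) (3 / 5 * Q)"
  using assms by (auto elim: edge_profile.cases)

lemma edge_profile_half_rises:
  assumes "edge_profile f P Q"
  shows "f (1 / 2) - f 0 = (4 * P + Q) / 15" "f 1 - f (1 / 2) = (P + 4 * Q) / 15"
  using edge_profileD(2)[OF edge_profileD(3)[OF assms]]
    edge_profileD(2)[OF edge_profileD(4)[OF assms]] by (simp_all add: field_simps)

lemma edge_profile_uminus:
  "edge_profile f P Q \<Longrightarrow> edge_profile (\<lambda>t. - f t) (- P) (- Q)"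
proof (coinduction arbitrary: f P Q)
  case edge_profile
  note D = edge_profileD[OF edge_profile]
  have "continuous_on {0..1} (\<lambda>t. - f t)"
    using D(1) by (rule continuous_on_minus)
  moreover have "- f 1 - - f 0 = (- P + - Q) / 3"
    using D(2) by (simp add: field_simps)
  moreover have "3 / 5 * - P = - (3 / 5 * P)" "3 / 5 * - Q = - (3 / 5 * Q)"
    "(- P + - Q) / 5 = - ((P + Q) / 5)"
    by (simp_all add: field_simps)
  ultimately show ?case
    using D(3,4) by metis
qed

text \<open>Reversing the direction exchanges the two slopes and their signs; statements about the
  second end follow from those about the first.\<close>

lemma edge_profile_reverse:
  "edge_profile f P Q \<Longrightarrow> edge_profile (\<lambda>t. f (1 - t)) (- Q) (- P)"
proof (coinduction arbitrary: f P Q)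
  case edge_profile
  note D = edge_profileD[OF edge_profile]
  have "continuous_on {0..1} (\<lambda>t. f (1 - t))"
    by (rule continuous_on_compose2[OF D(1)]) (auto intro!: continuous_intros)
  moreover have "f (1 - 1) - f (1 - 0) = (- Q + - P) / 3"
    using D(2) by (simp add: field_simps)
  moreover have "(\<lambda>t. f (1 - t / 2)) = (\<lambda>t. (\<lambda>s. f ((1 + s) / 2)) (1 - t))"
    "(\<lambda>t. f (1 - (1 + t) / 2)) = (\<lambda>t. (\<lambda>s. f (s / 2)) (1 - t))"
    by (auto simp: fun_eq_iff field_simps intro!: arg_cong[where f = f])
  moreover have "3 / 5 * - Q = - (3 / 5 * Q)" "3 / 5 * - P = - (3 / 5 * P)"
    "(- Q + - P) / 5 = - ((P + Q) / 5)"
    by (simp_all add: field_simps)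
  ultimately show ?case
    using D(3,4) by metis
qed

section \<open>Slopes of equal sign: strict monotonicity\<close>

text \<open>Every \<open>x\<close> has dyadic points \<open>y \<le> x\<close> arbitrarily near with \<open>f 0 \<le> f y\<close>, because the
  dyadic increments are positive; continuity carries the inequality to \<open>x\<close>.\<close>

lemma edge_profile_ge_start:
  assumes "edge_profile f P Q" "P \<ge> 0" "Q \<ge> 0" and x: "x \<in> {0..1}"
  shows "f 0 \<le> f x"
proof -
  have "\<exists>y\<in>{0..x}. x - y \<le> 1 / 2 ^ n \<and> f 0 \<le> f y" for n
    using assms
  proof (induction n arbitrary: f P Q x)
    case 0
    then show ?case by (intro bexI[of _ 0]) auto
  next
    case (Suc n)
    note D = edge_profileD[OF Suc.prems(1)]
    show ?case
    proof (cases "x \<le> 1 / 2")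
      case True
      obtain y where "y \<in> {0..2 * x}" "2 * x - y \<le> 1 / 2 ^ n" "f 0 \<le> f (y / 2)"
        using Suc.IH[OF D(3), of "2 * x"] Suc.prems True by auto
      then show ?thesis
        by (intro bexI[of _ "y / 2"]) (auto simp: field_simps)
    next
      case False
      obtain y where "y \<in> {0..2 * x - 1}" "2 * x - 1 - y \<le> 1 / 2 ^ n"
        "f (1 / 2) \<le> f ((1 + y) / 2)"
        using Suc.IH[OF D(4), of "2 * x - 1"] Suc.prems False by auto
      moreover have "f 0 \<le> f (1 / 2)"
        using edge_profile_half_rises(1)[OF Suc.prems(1)] Suc.prems by simp
      ultimately show ?thesis
        by (intro bexI[of _ "(1 + y) / 2"]) (auto simp: field_simps)
    qed
  qed
  then obtain y where y: "\<And>n. y n \<in> {0..x}" "\<And>n. x - y n \<le> 1 / 2 ^ n" "\<And>n. f 0 \<le> f (y n)"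
    by metis
  have "(\<lambda>n. x - y n) \<longlonglongrightarrow> 0"
    by (rule tendsto_sandwich[OF _ _ tendsto_const LIMSEQ_divide_realpow_zero[of 2 1]])
      (use y(1,2) in auto)
  from tendsto_diff[OF tendsto_const[of x] this] have "y \<longlonglongrightarrow> x"
    by simp
  then have "(\<lambda>n. f (y n)) \<longlonglongrightarrow> f x"
    using x y(1) order_trans
    by (intro continuous_on_tendsto_compose[OF edge_profileD(1)[OF assms(1)]] always_eventually)
      fastforce+
  then show ?thesis
    by (rule LIMSEQ_le_const) (use y(3) in blast)
qed

text \<open>Below \<open>x\<close> there is a subinterval starting at \<open>0\<close> whose rise is positive.\<close>

lemma edge_profile_gt_start:
  assumes "edge_profile f P Q" "P \<ge> 0" "Q \<ge> 0" "P + Q > 0" and x: "0 < x" "x \<le> 1"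
  shows "f 0 < f x"
proof -
  obtain n where "1 / x < 2 ^ n"
    using real_arch_pow[of 2 "1 / x"] by auto
  then have "1 \<le> 2 ^ n * x"
    using x by (simp add: field_simps)
  then show ?thesis
    using assms
  proof (induction n arbitrary: f P Q x)
    case 0
    then have "x = 1" by simp
    then show ?case using edge_profileD(2)[OF 0(2)] 0 by simp
  next
    case (Suc n)
    note D = edge_profileD[OF Suc.prems(2)]
    show ?case
    proof (cases "x \<le> 1 / 2")
      case True
      \<comment> \<open>If \<open>P = 0\<close>, the slope \<open>(P + Q) / 5\<close> at the midpoint keeps the sum positive.\<close>
      then have "f (0 / 2) < f (2 * x / 2)"
        using Suc.prems by (intro Suc.IH[OF _ D(3)]) (auto simp: field_simps)
      then show ?thesis by simp
    next
      case False
      have "f ((1 + 0) / 2) \<le> f ((1 + (2 * x - 1)) / 2)"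
        using Suc.prems False by (intro edge_profile_ge_start[OF D(4)]) auto
      moreover have "f 0 < f (1 / 2)"
        using edge_profile_half_rises(1)[OF Suc.prems(2)] Suc.prems by simp
      ultimately show ?thesis by simp
    qed
  qed
qed

lemma edge_profile_lt_end:
  assumes "edge_profile f P Q" "P \<ge> 0" "Q \<ge> 0" "P + Q > 0" "0 \<le> x" "x < 1"
  shows "f x < f 1"
  using edge_profile_gt_start[OF edge_profile_uminus[OF edge_profile_reverse[OF assms(1)]], of "1 - x"]
    assms(2-) by simp

text \<open>Two points are eventually separated by the midpoint of a dyadic subinterval, and then
  the bounds at its ends compare them.\<close>

lemma edge_profile_strict_mono:
  assumes "edge_profile f P Q" "P \<ge> 0" "Q \<ge> 0" "P + Q > 0"
  shows "strict_mono_on {0..1} f"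
proof (rule strict_mono_onI)
  fix s t :: real
  assume st: "s \<in> {0..1}" "t \<in> {0..1}" "s < t"
  obtain n where "1 / (t - s) < 2 ^ n"
    using real_arch_pow[of 2 "1 / (t - s)"] by auto
  then have "1 \<le> 2 ^ n * (t - s)"
    using st by (simp add: field_simps)
  then show "f s < f t"
    using assms st
  proof (induction n arbitrary: f P Q s t)
    case 0
    then have "s = 0" "t = 1" by auto
    then show ?case using edge_profileD(2)[OF 0(2)] 0 by simp
  next
    case (Suc n)
    note D = edge_profileD[OF Suc.prems(2)]
    consider "t \<le> 1 / 2" | "s \<ge> 1 / 2" | "s < 1 / 2" "1 / 2 < t" by linarith
    then show ?case
    proof cases
      case 1
      then have "f (2 * s / 2) < f (2 * t / 2)"
        using Suc.prems by (intro Suc.IH[OF _ D(3)]) (auto simp: field_simps)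
      then show ?thesis by simp
    next
      case 2
      then have "f ((1 + (2 * s - 1)) / 2) < f ((1 + (2 * t - 1)) / 2)"
        using Suc.prems by (intro Suc.IH[OF _ D(4)]) (auto simp: field_simps)
      then show ?thesis by simp
    next
      case 3
      have "f (2 * s / 2) < f (1 / 2)"
        using Suc.prems 3 by (intro edge_profile_lt_end[OF D(3)]) (auto simp: field_simps)
      moreover have "f ((1 + 0) / 2) < f ((1 + (2 * t - 1)) / 2)"
        using Suc.prems 3 by (intro edge_profile_gt_start[OF D(4)]) (auto simp: field_simps)
      ultimately show ?thesis by simp
    qed
  qed
qed

lemma edge_profile_strict_antimono:
  assumes "edge_profile f P Q" "P \<le> 0" "Q \<le> 0" "P + Q < 0"
  shows "strict_antimono_on {0..1} f"
  using edge_profile_strict_mono[OF edge_profile_uminus[OF assms(1)]] assms(2-)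
  by (auto simp: monotone_on_def)

section \<open>Slopes of opposite sign: a single peak\<close>

lemma strict_mono_on_glue:
  fixes f :: "real \<Rightarrow> real"
  assumes "strict_mono_on {a..b} f" "strict_mono_on {b..c} f"
  shows "strict_mono_on {a..c} f"
proof (rule strict_mono_onI)
  fix s t assume st: "s \<in> {a..c}" "t \<in> {a..c}" "s < t"
  consider "t \<le> b" | "b \<le> s" | "s < b" "b < t" by linarith
  then show "f s < f t"
  proof cases
    case 3
    then have "f s < f b" "f b < f t"
      using assms st by (auto intro: strict_mono_onD)
    then show ?thesis by simp
  qed (use assms st in \<open>auto intro: strict_mono_onD\<close>)
qed

lemma strict_antimono_on_glue:
  fixes f :: "real \<Rightarrow> real"
  assumes "strict_antimono_on {a..b} f" "strict_antimono_on {b..c} f"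
  shows "strict_antimono_on {a..c} f"
  using strict_mono_on_glue[of a b "\<lambda>t. - f t" c] assms by (simp add: monotone_on_def)

lemma monotone_on_left_half:
  fixes f :: "real \<Rightarrow> real"
  assumes "monotone_on {a..b} (<) R (\<lambda>t. f (t / 2))"
  shows "monotone_on {a / 2..b / 2} (<) R f"
proof (rule monotone_onI)
  fix s t assume "s \<in> {a / 2..b / 2}" "t \<in> {a / 2..b / 2}" "s < t"
  then show "R (f s) (f t)"
    using monotone_onD[OF assms, of "2 * s" "2 * t"] by simp
qed

lemma monotone_on_right_half:
  fixes f :: "real \<Rightarrow> real"
  assumes "monotone_on {a..b} (<) R (\<lambda>t. f ((1 + t) / 2))"
  shows "monotone_on {(1 + a) / 2..(1 + b) / 2} (<) R f"
proof (rule monotone_onI)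
  fix s t assume "s \<in> {(1 + a) / 2..(1 + b) / 2}" "t \<in> {(1 + a) / 2..(1 + b) / 2}" "s < t"
  then show "R (f s) (f t)"
    using monotone_onD[OF assms, of "2 * s - 1" "2 * t - 1"] by simp
qed

text \<open>The sign of the rise, which is also that of the slope at the midpoint, tells in which
  half the turning point lies. If the rise vanishes, both halves are monotone and the left
  one is chosen; it has slopes \<open>(3 P / 5, 0)\<close>, which is why zero slopes are admitted here.\<close>

lemma edge_profile_bracket:
  assumes "edge_profile f P Q" "P \<ge> 0" "Q \<le> 0" "P \<noteq> 0 \<or> Q \<noteq> 0"
  shows "\<exists>a b. 0 \<le> a \<and> a \<le> b \<and> b \<le> 1 \<and> b - a = 1 / 2 ^ n \<and>
    strict_mono_on {0..a} f \<and> strict_antimono_on {b..1} f"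
  using assms
proof (induction n arbitrary: f P Q)
  case 0
  then show ?case
    by (intro exI[of _ 0] exI[of _ 1]) (auto simp: monotone_on_def)
next
  case (Suc n)
  note D = edge_profileD[OF Suc.prems(1)]
  show ?case
  proof (cases "P + Q \<le> 0")
    case True
    have "\<exists>a b. 0 \<le> a \<and> a \<le> b \<and> b \<le> 1 \<and> b - a = 1 / 2 ^ n \<and>
      strict_mono_on {0..a} (\<lambda>t. f (t / 2)) \<and> strict_antimono_on {b..1} (\<lambda>t. f (t / 2))"
      using Suc.prems True by (intro Suc.IH[OF D(3)]) auto
    then obtain a b where ab: "0 \<le> a" "a \<le> b" "b \<le> 1" "b - a = 1 / 2 ^ n"
      and inc: "strict_mono_on {0..a} (\<lambda>t. f (t / 2))"
      and dec: "strict_antimono_on {b..1} (\<lambda>t. f (t / 2))" by blast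
    have "P + 4 * Q < 0"
      using Suc.prems True by (elim disjE) linarith+
    then have "strict_antimono_on {0..1} (\<lambda>t. f ((1 + t) / 2))"
      using Suc.prems True
      by (intro edge_profile_strict_antimono[OF D(4)]) (auto simp: field_simps)
    from monotone_on_right_half[OF this]
    have "strict_antimono_on {b / 2..1} f"
      using strict_antimono_on_glue[OF monotone_on_left_half[OF dec], of 1] by simp
    moreover have "strict_mono_on {0..a / 2} f"
      using monotone_on_left_half[OF inc] by simp
    ultimately show ?thesis
      using ab by (intro exI[of _ "a / 2"] exI[of _ "b / 2"]) (auto simp: field_simps)
  next
    case False
    have "\<exists>a b. 0 \<le> a \<and> a \<le> b \<and> b \<le> 1 \<and> b - a = 1 / 2 ^ n \<and>
      strict_mono_on {0..a} (\<lambda>t. f ((1 + t) / 2)) \<and>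
      strict_antimono_on {b..1} (\<lambda>t. f ((1 + t) / 2))"
      using Suc.prems False by (intro Suc.IH[OF D(4)]) auto
    then obtain a b where ab: "0 \<le> a" "a \<le> b" "b \<le> 1" "b - a = 1 / 2 ^ n"
      and inc: "strict_mono_on {0..a} (\<lambda>t. f ((1 + t) / 2))"
      and dec: "strict_antimono_on {b..1} (\<lambda>t. f ((1 + t) / 2))" by blast
    have "strict_mono_on {0..1} (\<lambda>t. f (t / 2))"
      using Suc.prems False
      by (intro edge_profile_strict_mono[OF D(3)]) (auto simp: field_simps)
    from monotone_on_left_half[OF this]
    have "strict_mono_on {0..(1 + a) / 2} f"
      using strict_mono_on_glue[OF _ monotone_on_right_half[OF inc], of 0] by simp
    moreover have "strict_antimono_on {(1 + b) / 2..1} f"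
      using monotone_on_right_half[OF dec] by simp
    ultimately show ?thesis
      using ab by (intro exI[of _ "(1 + a) / 2"] exI[of _ "(1 + b) / 2"]) (auto simp: field_simps)
  qed
qed

text \<open>A point where the maximum is attained lies in every bracket, and the brackets shrink to
  it.\<close>

lemma edge_profile_peak_closed:
  assumes f: "edge_profile f P Q" and PQ: "P \<ge> 0" "Q \<le> 0" "P \<noteq> 0 \<or> Q \<noteq> 0"
  obtains x where "x \<in> {0..1}" "strict_mono_on {0..x} f" "strict_antimono_on {x..1} f"
proof -
  obtain x where x: "x \<in> {0..1}" and max: "\<And>t. t \<in> {0..1} \<Longrightarrow> f t \<le> f x"
    using continuous_attains_sup[OF _ _ edge_profileD(1)[OF f]] by auto
  have near: "\<exists>a b. a \<in> {0..x} \<and> b \<in> {x..1} \<and> x - a < e \<and> b - x < e \<and>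
    strict_mono_on {0..a} f \<and> strict_antimono_on {b..1} f" if "e > 0" for e
  proof -
    obtain n where "1 / e < 2 ^ n"
      using real_arch_pow[of 2 "1 / e"] by auto
    then have n: "1 / 2 ^ n < e"
      using that by (simp add: field_simps)
    obtain a b where ab: "0 \<le> a" "a \<le> b" "b \<le> 1" "b - a = 1 / 2 ^ n"
      "strict_mono_on {0..a} f" "strict_antimono_on {b..1} f"
      using edge_profile_bracket[OF f PQ] by metis
    have "\<not> x < a"
      using strict_mono_onD[OF ab(5), of x a] max[of a] ab x by auto
    moreover have "\<not> b < x"
      using monotone_onD[OF ab(6), of b x] max[of b] ab x by auto
    ultimately show ?thesis
      using ab n x by (intro exI[of _ a] exI[of _ b]) auto
  qed
  have lt: "f s < f t" if "0 \<le> s" "s < t" "t < x" for s t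
    using near[of "x - t"] that by (auto dest!: strict_mono_onD[of _ f s t])
  have gt: "f s > f t" if "x < s" "s < t" "t \<le> 1" for s t
    using near[of "s - x"] that by (auto dest!: monotone_onD[of _ _ _ f s t])
  show ?thesis
  proof (rule that[OF x])
    show "strict_mono_on {0..x} f"
    proof (rule strict_mono_onI)
      fix s t assume "s \<in> {0..x}" "t \<in> {0..x}" "s < t"
      then show "f s < f t"
        using lt[of s t] lt[of s "(s + x) / 2"] max[of "(s + x) / 2"] x by (cases "t = x") auto
    qed
    show "strict_antimono_on {x..1} f"
    proof (rule monotone_onI)
      fix s t assume "s \<in> {x..1}" "t \<in> {x..1}" "s < t"
      then show "f s > f t"
        using gt[of s t] gt[of "(x + t) / 2" t] max[of "(x + t) / 2"] x by (cases "s = x") auto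
    qed
  qed
qed

section \<open>Growth at an end of the interval\<close>

text \<open>The slopes of the initial subinterval evolve linearly, with eigenvalues \<open>3/5\<close> (direction
  \<open>(2, 1)\<close>) and \<open>1/5\<close> (direction \<open>(0, 1)\<close>); this is the decomposition of \<open>(P, Q)\<close>.\<close>

lemma edge_profile_initial_rise:
  assumes "edge_profile f P Q"
  shows "f (1 / 2 ^ n) - f 0 = (3 / 5) ^ n * (P / 2) + (1 / 5) ^ n * ((2 * Q - P) / 6)"
  using assms
proof (induction n arbitrary: f P Q)
  case 0
  then show ?case using edge_profileD(2)[OF 0] by (simp add: field_simps)
next
  case (Suc n)
  have "f (1 / 2 ^ Suc n) - f 0 = (3 / 5) ^ n * (3 / 5 * P / 2) +
      (1 / 5) ^ n * ((2 * ((P + Q) / 5) - 3 / 5 * P) / 6)"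
    using Suc.IH[OF edge_profileD(3)[OF Suc.prems]] by (simp add: mult.commute)
  also have "\<dots> = (3 / 5) ^ Suc n * (P / 2) + (1 / 5) ^ Suc n * ((2 * Q - P) / 6)"
    by (simp add: add_divide_distrib diff_divide_distrib algebra_simps)
  finally show ?case .
qed

text \<open>Multiplication by \<open>2^n\<close> turns the eigenvalues into \<open>6/5\<close> and \<open>2/5\<close>.\<close>

lemma edge_profile_quotient:
  assumes "edge_profile f P Q"
  shows "P > 0 \<Longrightarrow> filterlim (\<lambda>n. 2 ^ n * (f (1 / 2 ^ n) - f 0)) at_top sequentially"
    and "P = 0 \<Longrightarrow> (\<lambda>n. 2 ^ n * (f (1 / 2 ^ n) - f 0)) \<longlonglongrightarrow> 0"
proof -
  have eq: "2 ^ n * (f (1 / 2 ^ n) - f 0) = (2 / 5) ^ n * ((2 * Q - P) / 6) + (6 / 5) ^ n * (P / 2)" for n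
    by (simp add: edge_profile_initial_rise[OF assms] power_divide field_simps flip: power_mult_distrib)
  have small: "(\<lambda>n. (2 / 5) ^ n * ((2 * Q - P) / 6)) \<longlonglongrightarrow> 0"
    by (intro tendsto_mult_left_zero LIMSEQ_power_zero) simp
  show "(\<lambda>n. 2 ^ n * (f (1 / 2 ^ n) - f 0)) \<longlonglongrightarrow> 0" if "P = 0"
    using small that by (simp add: eq)
  show "filterlim (\<lambda>n. 2 ^ n * (f (1 / 2 ^ n) - f 0)) at_top sequentially" if "P > 0"
  proof -
    have "filterlim (\<lambda>n. (6 / 5 :: real) ^ n) at_top sequentially"
      using filterlim_realpow_sequentially_gt1[of "6 / 5 :: real"]
      by (simp add: filterlim_at_infinity_conv_norm_at_top norm_power)
    then have "filterlim (\<lambda>n. (6 / 5) ^ n * (P / 2)) at_top sequentially"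
      using that by (intro filterlim_at_top_mult_tendsto_pos[OF tendsto_const]) auto
    then show ?thesis
      unfolding eq by (rule filterlim_tendsto_add_at_top[OF small])
  qed
qed

text \<open>The function leaves \<open>0\<close> upwards when \<open>P > 0\<close>, so the peak is not there; by symmetry it is
  not at \<open>1\<close> either.\<close>

lemma edge_profile_peak:
  assumes f: "edge_profile f P Q" and PQ: "P > 0" "Q < 0"
  obtains x where "0 < x" "x < 1" "strict_mono_on {0..x} f" "strict_antimono_on {x..1} f"
proof -
  have rises: "\<exists>t\<in>{0<..1}. g 0 < g t" if "edge_profile g A B" "A > 0" for g A B
  proof -
    have "eventually (\<lambda>n. 0 < 2 ^ n * (g (1 / 2 ^ n) - g 0)) sequentially"
      using edge_profile_quotient(1)[OF that] by (simp add: filterlim_at_top_dense)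
    then obtain n where "0 < 2 ^ n * (g (1 / 2 ^ n) - g 0)"
      by (auto simp: eventually_sequentially)
    then show ?thesis
      by (intro bexI[of _ "1 / 2 ^ n"]) (auto simp: zero_less_mult_iff)
  qed
  obtain x where x: "x \<in> {0..1}" "strict_mono_on {0..x} f" "strict_antimono_on {x..1} f"
    using edge_profile_peak_closed[OF f] PQ by (metis less_eq_real_def less_irrefl)
  have "x \<noteq> 0"
    using rises[OF f PQ(1)] monotone_onD[OF x(3), of 0] by force
  moreover have "x \<noteq> 1"
  proof
    assume [simp]: "x = 1"
    obtain t where "t \<in> {0<..1}" "f 1 < f (1 - t)"
      using rises[OF edge_profile_reverse[OF f]] PQ by auto
    then show False
      using monotone_onD[OF x(2), of "1 - t" 1] by auto
  qed
  ultimately show ?thesis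
    using x by (intro that[of x]) auto
qed

section \<open>Harmonic functions restricted to edges\<close>

lemma halve_eq_midpoint: "halve c x = midpoint c x"
  by (simp add: halve_def midpoint_def vec_eq_iff field_simps)

lemma halve_linepath: "halve c (linepath a b t) = linepath (halve c a) (halve c b) t"
  by (simp add: halve_def linepath_def vec_eq_iff field_simps)

lemma halve_linepath_start: "halve a (linepath a b t) = linepath a b (t / 2)"
  by (simp add: halve_def linepath_def vec_eq_iff field_simps)

lemma halve_linepath_end: "halve b (linepath a b t) = linepath a b ((1 + t) / 2)"
  by (simp add: halve_def linepath_def vec_eq_iff field_simps)

lemma word_map_append: "word_map c (u @ v) x = word_map c u (word_map c v x)"
  by (simp add: word_map_def)

lemma word_map_linepath:
  "word_map c w (linepath a b t) = linepath (word_map c w a) (word_map c w b) t"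
  by (induction w) (simp_all add: halve_linepath)

lemma word_map_midpoint:
  "word_map c w (midpoint a b) = midpoint (word_map c w a) (word_map c w b)"
  using word_map_linepath[of c w a b "1 / 2"] by (simp add: linepath_def midpoint_def scaleR_add_right)

lemma word_map_subcell:
  "word_map q (w @ [i]) (q j) = midpoint (word_map q w (q i)) (word_map q w (q j))"
  by (simp add: word_map_append halve_eq_midpoint word_map_midpoint)

lemma word_map_mem_SG:
  assumes "set w \<subseteq> {0,1,2}" "x \<in> SG q"
  shows "word_map q w x \<in> SG q"
  using assms by (induction w) (auto intro: is_attractor_step[OF is_attractor_SG])

text \<open>The points of the gasket on a side of the triangle contain the ends and are closed under
  the two contractions of that side, so they are dense in the side; the gasket is closed.\<close>

lemma linepath_vertices_mem_SG:
  assumes ij: "i \<in> {0,1,2}" "j \<in> {0,1,2}" and t: "t \<in> {0..1}"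
  shows "linepath (q i) (q j) t \<in> SG q"
proof -
  have "\<exists>s. \<bar>s - t\<bar> \<le> 1 / 2 ^ n \<and> linepath (q i) (q j) s \<in> SG q" for n
    using t
  proof (induction n arbitrary: t)
    case 0
    then show ?case
      using is_attractor_vertex_mem[OF is_attractor_SG ij(1)]
      by (intro exI[of _ 0]) (auto simp: linepath_0')
  next
    case (Suc n)
    show ?case
    proof (cases "t \<le> 1 / 2")
      case True
      obtain s where "\<bar>s - 2 * t\<bar> \<le> 1 / 2 ^ n" and s: "linepath (q i) (q j) s \<in> SG q"
        using Suc.IH[of "2 * t"] Suc.prems True by auto
      then show ?thesis
        using is_attractor_step[OF is_attractor_SG ij(1) s]
        by (intro exI[of _ "s / 2"]) (auto simp: halve_linepath_start abs_le_iff field_simps)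
    next
      case False
      obtain s where "\<bar>s - (2 * t - 1)\<bar> \<le> 1 / 2 ^ n" and s: "linepath (q i) (q j) s \<in> SG q"
        using Suc.IH[of "2 * t - 1"] Suc.prems False by auto
      then show ?thesis
        using is_attractor_step[OF is_attractor_SG ij(2) s]
        by (intro exI[of _ "(1 + s) / 2"]) (auto simp: halve_linepath_end abs_le_iff field_simps)
    qed
  qed
  then obtain s where s: "\<And>n. \<bar>s n - t\<bar> \<le> 1 / 2 ^ n"
    and mem: "\<And>n. linepath (q i) (q j) (s n) \<in> SG q" by metis
  have "(\<lambda>n. s n - t) \<longlonglongrightarrow> 0"
    by (rule Lim_null_comparison[OF _ LIMSEQ_divide_realpow_zero[of 2 1]]) (use s in auto)
  then have "s \<longlonglongrightarrow> t"
    by (simp add: LIM_zero_iff)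
  then have "(\<lambda>n. linepath (q i) (q j) (s n)) \<longlonglongrightarrow> linepath (q i) (q j) t"
    unfolding linepath_def by (intro tendsto_intros)
  moreover have "closed (SG q)"
    using is_attractor_SG by (auto simp: is_attractor_def intro: compact_imp_closed)
  ultimately show ?thesis
    using mem by (metis closed_sequentially)
qed

lemma harmonic_subcell:
  assumes "harmonic q h" "set w \<subseteq> {0,1,2}" "{i,j,k} = {0,1,2}"
  shows "h (word_map q (w @ [i]) (q j)) =
    2 / 5 * h (word_map q w (q i)) + 2 / 5 * h (word_map q w (q j)) + 1 / 5 * h (word_map q w (q k))"
  unfolding word_map_subcell using assms unfolding harmonic_def by blast

lemma word_map_subcell_same: "word_map q (w @ [i]) (q i) = word_map q w (q i)"
  by (simp add: word_map_subcell)

text \<open>The rise and the slopes are those of the cell; the half at an end of the edge belongs to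
  the subcell at that end.\<close>

lemma harmonic_edge_profile:
  assumes h: "harmonic q h" and w: "set w \<subseteq> {0,1,2}" "{i,j,k} = {0,1,2}"
  defines "v \<equiv> \<lambda>w l. word_map q w (q l)"
  shows "edge_profile (h \<circ> linepath (v w i) (v w j))
    (h (v w j) + h (v w k) - 2 * h (v w i)) (2 * h (v w j) - h (v w i) - h (v w k))"
proof -
  \<comment> \<open>the invariant of the coinduction: being the restriction to an edge of some cell\<close>
  define X where "X f P Q \<longleftrightarrow> (\<exists>w i j k. set w \<subseteq> {0,1,2} \<and> {i,j,k} = {0,1,2} \<and>
      f = h \<circ> linepath (v w i) (v w j) \<and>
      P = h (v w j) + h (v w k) - 2 * h (v w i) \<and> Q = 2 * h (v w j) - h (v w i) - h (v w k))"
    for f P Q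
  have "edge_profile f P Q" if "X f P Q" for f P Q
    using that
  proof (coinduction arbitrary: f P Q)
    case edge_profile
    then obtain w i j k where w: "set w \<subseteq> {0,1,2}" and ijk: "{i,j,k} = {0,1,2}"
      and f: "f = h \<circ> linepath (v w i) (v w j)"
      and P: "P = h (v w j) + h (v w k) - 2 * h (v w i)"
      and Q: "Q = 2 * h (v w j) - h (v w i) - h (v w k)"
      unfolding X_def by blast
    have ij: "i \<in> {0,1,2}" "j \<in> {0,1,2}"
      using ijk by blast+
    have perm: "{i,k,j} = {0,1,2}" "{j,i,k} = {0,1,2}" "{j,k,i} = {0,1,2}"
      unfolding ijk[symmetric] by blast+
    have sub: "v (w @ [i]) i = v w i" "v (w @ [j]) j = v w j"
      unfolding v_def by (rule word_map_subcell_same)+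
    have val: "h (v (w @ [l]) l') = 2 / 5 * h (v w l) + 2 / 5 * h (v w l') + 1 / 5 * h (v w l'')"
      if "{l,l',l''} = {0,1,2}" for l l' l''
      unfolding v_def by (rule harmonic_subcell[OF h w that])
    note vals = val[OF ijk] val[OF perm(1)] val[OF perm(2)] val[OF perm(3)]
    have "continuous_on {0..1} f"
      unfolding f o_def
    proof (rule continuous_on_compose2[of "SG q" h])
      show "continuous_on (SG q) h"
        using h by (simp add: harmonic_def)
      show "linepath (v w i) (v w j) ` {0..1} \<subseteq> SG q"
        by (auto simp: v_def linepath_vertices_mem_SG[OF ij] simp flip: word_map_linepath
            intro!: word_map_mem_SG[OF w])
    qed (rule continuous_on_linepath)
    moreover have "f 1 - f 0 = (P + Q) / 3"
      by (simp add: f P Q linepath_0' linepath_1' field_simps)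
    moreover have "X (\<lambda>t. f (t / 2)) (3 / 5 * P) ((P + Q) / 5)"
      unfolding X_def
    proof (rule exI[of _ "w @ [i]"], rule exI[of _ i], rule exI[of _ j], rule exI[of _ k],
        intro conjI)
      have "linepath (v w i) (v w j) (t / 2) = linepath (v (w @ [i]) i) (v (w @ [i]) j) t" for t
        unfolding v_def word_map_linepath[symmetric] word_map_append
        by (simp add: halve_linepath_start)
      then show "(\<lambda>t. f (t / 2)) = h \<circ> linepath (v (w @ [i]) i) (v (w @ [i]) j)"
        by (simp add: f fun_eq_iff)
    qed (use w ij ijk vals in \<open>simp_all add: sub P Q field_simps\<close>)
    moreover have "X (\<lambda>t. f ((1 + t) / 2)) ((P + Q) / 5) (3 / 5 * Q)"
      unfolding X_def
    proof (rule exI[of _ "w @ [j]"], rule exI[of _ i], rule exI[of _ j], rule exI[of _ k],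
        intro conjI)
      have "linepath (v w i) (v w j) ((1 + t) / 2) = linepath (v (w @ [j]) i) (v (w @ [j]) j) t" for t
        unfolding v_def word_map_linepath[symmetric] word_map_append
        by (simp add: halve_linepath_end)
      then show "(\<lambda>t. f ((1 + t) / 2)) = h \<circ> linepath (v (w @ [j]) i) (v (w @ [j]) j)"
        by (simp add: f fun_eq_iff)
    qed (use w ij ijk vals in \<open>simp_all add: sub P Q field_simps\<close>)
    ultimately show ?case
      by blast
  qed
  then show ?thesis
    unfolding X_def using w by blast
qed

text \<open>Constancy passes from a cell to the cell around it, because the midpoint rule can be
  solved for the two outer vertices, and from the whole triangle to all cells; the vertices of
  the cells are dense.\<close>

lemma harmonic_constant_cell:
  assumes h: "harmonic q h" and w: "set w \<subseteq> {0,1,2}"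
    and const: "\<And>i. i \<in> {0,1,2} \<Longrightarrow> h (word_map q w (q i)) = c"
  shows "h constant_on SG q"
proof -
  have others: "{i, (i + 1) mod 3, (i + 2) mod 3} = {0,1,2}" if "i \<in> {0,1,2}" for i :: nat
    using that by auto
  have up: "\<forall>i\<in>{0,1,2}. h (q i) = c"
    using w const
  proof (induction w rule: rev_induct)
    case Nil
    then show ?case by simp
  next
    case (snoc i w)
    have i: "i \<in> {0,1,2}" and w: "set w \<subseteq> {0,1,2}"
      using snoc.prems by auto
    obtain j k where ijk: "{i,j,k} = {0,1,2}"
      using others[OF i] by blast
    have ikj: "{i,k,j} = {0,1,2}"
      unfolding ijk[symmetric] by blast
    have mem: "j \<in> {0,1,2}" "k \<in> {0,1,2}"
      using ijk by blast+
    have "h (word_map q w (q i)) = c"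
      using snoc.prems(2)[OF i] by (simp only: word_map_subcell_same)
    moreover from this have "h (word_map q w (q j)) = c" "h (word_map q w (q k)) = c"
      using snoc.prems(2)[OF mem(1)] snoc.prems(2)[OF mem(2)]
      unfolding harmonic_subcell[OF h w ijk] harmonic_subcell[OF h w ikj] by linarith+
    ultimately have "\<forall>l\<in>{i,j,k}. h (word_map q w (q l)) = c"
      by simp
    then show ?case
      unfolding ijk using snoc.IH[OF w] by blast
  qed
  have down: "\<forall>i\<in>{0,1,2}. h (word_map q u (q i)) = c" if "set u \<subseteq> {0,1,2}" for u
    using that
  proof (induction u rule: rev_induct)
    case Nil
    then show ?case using up by simp
  next
    case (snoc i u)
    have i: "i \<in> {0,1,2}" and u: "set u \<subseteq> {0,1,2}"
      using snoc.prems by auto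
    obtain j k where ijk: "{i,j,k} = {0,1,2}"
      using others[OF i] by blast
    have ikj: "{i,k,j} = {0,1,2}"
      unfolding ijk[symmetric] by blast
    have *: "h (word_map q u (q l)) = c" if "l \<in> {i,j,k}" for l
      using snoc.IH[OF u] that unfolding ijk by blast
    have "\<forall>l\<in>{i,j,k}. h (word_map q (u @ [i]) (q l)) = c"
      using *[of i] *[of j] *[of k]
      by (simp add: word_map_subcell_same harmonic_subcell[OF h u ijk] harmonic_subcell[OF h u ikj]
          del: word_map_simps)
    then show ?case
      unfolding ijk .
  qed
  let ?S = "{word_map q w (q 0) | w. set w \<subseteq> {0,1,2}}"
  have SG: "SG q = closure ?S"
    by (rule is_attractor_eq_closure[OF is_attractor_SG])
  have "h x = c" if "x \<in> SG q" for x
  proof (rule continuous_constant_on_closure[where f = h and S = ?S])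
    show "continuous_on (closure ?S) h"
      using h unfolding SG[symmetric] harmonic_def by blast
    show "x \<in> closure ?S"
      using that unfolding SG .
  qed (use down in blast)
  then show ?thesis
    by (auto simp: constant_on_def)
qed

text \<open>Vanishing slopes at both ends force equal values at the three vertices of the cell.\<close>

lemma harmonic_edge:
  assumes q: "equilateral q" and h: "harmonic q h" "\<not> h constant_on SG q"
    and E: "is_edge q m (closed_segment a b)"
  obtains P Q where "edge_profile (h \<circ> linepath a b) P Q" "P \<noteq> 0 \<or> Q \<noteq> 0" "a \<noteq> b"
proof -
  obtain w i j where w: "set w \<subseteq> {0,1,2}" and ij: "i \<in> {0,1,2}" "j \<in> {0,1,2}" "i \<noteq> j"
    and "closed_segment a b = closed_segment (word_map q w (q i)) (word_map q w (q j))"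
    using E unfolding is_edge_def by (elim exE conjE) (rule that)
  then have "a = word_map q w (q i) \<and> b = word_map q w (q j) \<or>
      a = word_map q w (q j) \<and> b = word_map q w (q i)"
    unfolding closed_segment_eq by (simp add: doubleton_eq_iff)
  then obtain i j where ij: "i \<in> {0,1,2}" "j \<in> {0,1,2}" "i \<noteq> j"
    and ab: "a = word_map q w (q i)" "b = word_map q w (q j)"
    using ij by metis
  \<comment> \<open>the remaining index, as the three indices add up to \<open>3\<close>\<close>
  define k where "k = 3 - i - j"
  have ijk: "{i,j,k} = {0,1,2}"
    using ij by (auto simp: k_def)
  let ?v = "\<lambda>l. word_map q w (q l)"
  show ?thesis
  proof (rule that)
    show "edge_profile (h \<circ> linepath a b)
        (h (?v j) + h (?v k) - 2 * h (?v i)) (2 * h (?v j) - h (?v i) - h (?v k))"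
      using harmonic_edge_profile[OF h(1) w ijk] by (simp only: ab)
    show "h (?v j) + h (?v k) - 2 * h (?v i) \<noteq> 0 \<or> 2 * h (?v j) - h (?v i) - h (?v k) \<noteq> 0"
    proof (rule ccontr)
      assume "\<not> ?thesis"
      then have "h (?v i) = h (?v k) \<and> h (?v j) = h (?v k)" by linarith
      then have "\<forall>l\<in>{i,j,k}. h (?v l) = h (?v k)" by simp
      then have "h constant_on SG q"
        unfolding ijk by (intro harmonic_constant_cell[OF h(1) w, of "h (?v k)"]) blast
      then show False using h(2) by simp
    qed
    have "q i \<noteq> q j"
      using q ij unfolding equilateral_def by auto
    then show "a \<noteq> b"
      using dist_word_map[of q w "q i" "q j"] by (auto simp: ab)
  qed
qed

section \<open>Extrema, growth and ratio of an edge\<close>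

lemma local_extremum_on_uminus:
  "local_extremum_on E (\<lambda>x. - g x) z \<longleftrightarrow> local_extremum_on E g z"
  by (auto simp: local_extremum_on_def)

text \<open>Apart from the peak, every inner point has larger values on one side and smaller values
  on the other, arbitrarily near.\<close>

lemma peak_unique_local_extremum:
  fixes a b :: "real^2" and x :: real
  assumes x: "0 < x" "x < 1" and ne: "a \<noteq> b"
    and inc: "strict_mono_on {0..x} (g \<circ> linepath a b)"
    and dec: "strict_antimono_on {x..1} (g \<circ> linepath a b)"
  shows "\<exists>!z. z \<in> closed_segment a b - {a, b} \<and> local_extremum_on (closed_segment a b) g z"
proof (rule ex1I)
  let ?L = "linepath a b"
  have L: "?L t \<in> closed_segment a b" if "t \<in> {0..1}" for t
    using that by (simp add: linepath_in_path)
  have diff: "?L s - ?L t = (s - t) *\<^sub>R (b - a)" for s t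
    by (simp add: linepath_def algebra_simps)
  have inj: "?L s = ?L t \<longleftrightarrow> s = t" for s t
    using ne diff[of s t] by (metis eq_iff_diff_eq_0 scaleR_eq_0_iff)
  have lt: "g (?L s) < g (?L t)" if "s < t" "0 \<le> s" "t \<le> x" for s t
    using strict_mono_onD[OF inc, of s t] that by simp
  have gt: "g (?L s) > g (?L t)" if "s < t" "x \<le> s" "t \<le> 1" for s t
    using monotone_onD[OF dec, of s t] that by simp
  have "g y \<le> g (?L x)" if y: "y \<in> closed_segment a b" for y
  proof -
    obtain t where t: "t \<in> {0..1}" "y = ?L t"
      using y by (auto simp flip: linepath_image_01)
    then show ?thesis
      using lt[of t x] gt[of x t] x by (cases t x rule: linorder_cases) auto
  qed
  then show "?L x \<in> closed_segment a b - {a, b} \<and> local_extremum_on (closed_segment a b) g (?L x)"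
    using L[of x] x inj[of x 0] inj[of x 1]
    by (auto simp: local_extremum_on_def eventually_at_filter linepath_0' linepath_1')
  fix z
  assume z: "z \<in> closed_segment a b - {a, b} \<and> local_extremum_on (closed_segment a b) g z"
  then obtain t where t: "t \<in> {0..1}" "z = ?L t"
    by (auto simp flip: linepath_image_01)
  with z have t01: "0 < t" "t < 1"
    by (auto simp: linepath_0' linepath_1' less_le)
  obtain d where d: "d > 0" and ext:
    "(\<forall>y\<in>closed_segment a b. y \<noteq> z \<and> dist y z < d \<longrightarrow> g y \<le> g z) \<or>
     (\<forall>y\<in>closed_segment a b. y \<noteq> z \<and> dist y z < d \<longrightarrow> g z \<le> g y)"
    using z unfolding local_extremum_on_def eventually_at by auto
  have near: "(\<forall>s\<in>{0..1}. s \<noteq> t \<and> \<bar>s - t\<bar> * dist a b < d \<longrightarrow> g (?L s) \<le> g (?L t)) \<or>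
     (\<forall>s\<in>{0..1}. s \<noteq> t \<and> \<bar>s - t\<bar> * dist a b < d \<longrightarrow> g (?L t) \<le> g (?L s))"
  proof -
    have "dist (?L s) (?L t) = \<bar>s - t\<bar> * dist a b" for s
      by (simp add: dist_norm diff norm_minus_commute)
    then show ?thesis
      using ext L t inj by auto
  qed
  \<comment> \<open>a step that stays in the neighbourhood, in the unit interval, and on one side of the peak\<close>
  define e where "e = min (d / (2 * dist a b)) (min (min t (1 - t)) \<bar>t - x\<bar>)"
  have ab: "dist a b > 0"
    using ne by simp
  have e: "e * dist a b < d" "e \<le> t" "e \<le> 1 - t" "e \<le> \<bar>t - x\<bar>"
  proof -
    have "e \<le> d / (2 * dist a b)"
      by (simp add: e_def)
    then show "e * dist a b < d"
      using ab d by (simp add: field_simps)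
  qed (simp_all add: e_def)
  have e0: "e > 0" if "t \<noteq> x"
    using that d ab t01 by (simp add: e_def)
  have step: "t - e \<in> {0..1}" "t + e \<in> {0..1}" "t - e \<noteq> t" "t + e \<noteq> t"
    "\<bar>t - e - t\<bar> * dist a b < d" "\<bar>t + e - t\<bar> * dist a b < d" if "t \<noteq> x"
    using e e0[OF that] by simp_all
  have "g (?L (t - e)) \<le> g (?L t) \<and> g (?L (t + e)) \<le> g (?L t) \<or>
      g (?L t) \<le> g (?L (t - e)) \<and> g (?L t) \<le> g (?L (t + e))" if "t \<noteq> x"
    using near step[OF that] by blast
  moreover have "g (?L (t - e)) < g (?L t)" "g (?L t) < g (?L (t + e))" if "t < x"
    using that e e0 by (auto intro!: lt)
  moreover have "g (?L (t - e)) > g (?L t)" "g (?L t) > g (?L (t + e))" if "t > x"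
    using that e e0 by (auto intro!: gt)
  ultimately show "z = ?L x"
    unfolding t(2) by (metis linorder_neqE_linordered_idom not_less)
qed

lemma word_map_replicate:
  "word_map c (replicate l i) x = linepath (c i) x (1 / 2 ^ l)"
proof (induction l)
  case 0
  then show ?case by (simp add: linepath_1')
next
  case (Suc l)
  then show ?case by (simp add: halve_linepath_start mult.commute)
qed

lemma alpha_quotient_limit:
  assumes f: "edge_profile (h \<circ> linepath (p 0) (p 1)) P Q" and ne: "p 0 \<noteq> p 1"
  shows "P = 0 \<Longrightarrow> alpha_quotient h p \<longlonglongrightarrow> 0"
    and "P \<noteq> 0 \<Longrightarrow> alpha_quotient h p \<longlonglongrightarrow> \<infinity>"
proof -
  let ?f = "h \<circ> linepath (p 0) (p 1)"
  let ?d = "\<lambda>n. 2 ^ n * (?f (1 / 2 ^ n) - ?f 0)"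
  have eq: "alpha_quotient h p = (\<lambda>n. ereal (\<bar>?d n\<bar> / dist (p 0) (p 1)))"
  proof
    fix n
    have "linepath (p 0) (p 1) (1 / 2 ^ n) - p 0 = (1 / 2 ^ n) *\<^sub>R (p 1 - p 0)"
      by (simp add: linepath_def algebra_simps)
    then have "norm (linepath (p 0) (p 1) (1 / 2 ^ n) - p 0) = dist (p 0) (p 1) / 2 ^ n"
      by (simp add: dist_norm norm_minus_commute)
    then show "alpha_quotient h p n = ereal (\<bar>?d n\<bar> / dist (p 0) (p 1))"
      by (simp add: alpha_quotient_def word_map_replicate Let_def abs_mult linepath_0' mult.commute)
  qed
  show "alpha_quotient h p \<longlonglongrightarrow> 0" if "P = 0"
  proof -
    have "(\<lambda>n. \<bar>?d n\<bar> / dist (p 0) (p 1)) \<longlonglongrightarrow> \<bar>0\<bar> / dist (p 0) (p 1)"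
      using edge_profile_quotient(2)[OF f that] ne by (intro tendsto_intros) auto
    then show ?thesis
      unfolding eq zero_ereal_def by simp
  qed
  show "alpha_quotient h p \<longlonglongrightarrow> \<infinity>" if "P \<noteq> 0"
  proof -
    have "filterlim (\<lambda>n. \<bar>?d n\<bar>) at_top sequentially"
    proof (cases "P > 0")
      case True
      show ?thesis
        by (rule filterlim_at_top_mono[OF edge_profile_quotient(1)[OF f True]])
          (intro always_eventually allI abs_ge_self)
    next
      case False
      then have "filterlim (\<lambda>n. 2 ^ n * (- ?f (1 / 2 ^ n) - - ?f 0)) at_top sequentially"
        using that by (intro edge_profile_quotient(1)[OF edge_profile_uminus[OF f]]) auto
      also have "(\<lambda>n. 2 ^ n * (- ?f (1 / 2 ^ n) - - ?f 0)) = (\<lambda>n. - ?d n)"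
        by (simp add: fun_eq_iff algebra_simps)
      finally show ?thesis
        by (rule filterlim_at_top_mono) (intro always_eventually allI abs_ge_minus_self)
    qed
    then have "filterlim (\<lambda>n. \<bar>?d n\<bar> * (1 / dist (p 0) (p 1))) at_top sequentially"
      using ne by (intro filterlim_at_top_mult_tendsto_pos[OF tendsto_const]) auto
    then show ?thesis
      unfolding eq tendsto_PInfty_eq_at_top by simp
  qed
qed

text \<open>On the indices \<open>0\<close> and \<open>1\<close>, the map \<open>i \<mapsto> 1 - i\<close> exchanges the ends of the edge.\<close>

lemma beta_quotient_eq_alpha_quotient:
  "beta_quotient h p = alpha_quotient h (\<lambda>i. p (1 - i))"
  by (simp add: fun_eq_iff beta_quotient_def alpha_quotient_def word_map_replicate)

text \<open>With \<open>u\<close>, \<open>v\<close> the rises over the two halves and \<open>r = v / u\<close>, the slopes are \<open>P = 4 u - v\<close>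
  and \<open>Q = 4 v - u\<close>, so \<open>P Q = u\<^sup>2 (4 - r) (4 r - 1)\<close>. The case \<open>u = 0\<close> is \<open>r = \<infinity>\<close>, where
  \<open>P Q = - 4 v\<^sup>2\<close> is negative.\<close>

lemma edge_ratio_slopes:
  assumes f: "edge_profile (h \<circ> linepath (p 0) (p 1)) P Q" and PQ: "P \<noteq> 0 \<or> Q \<noteq> 0"
  shows "ereal (1 / 4) \<le> edge_ratio h p \<and> edge_ratio h p \<le> ereal 4 \<longleftrightarrow> 0 \<le> P * Q"
    and "edge_ratio h p = ereal 4 \<longleftrightarrow> P = 0"
    and "edge_ratio h p = ereal (1 / 4) \<longleftrightarrow> Q = 0"
proof -
  let ?c = "midpoint (p 0) (p 1)"
  define u where "u = h ?c - h (p 0)"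
  define v where "v = h (p 1) - h ?c"
  have "linepath (p 0) (p 1) (1 / 2) = ?c"
    by (simp add: linepath_def midpoint_def scaleR_add_right)
  then have uv: "u = (4 * P + Q) / 15" "v = (P + 4 * Q) / 15"
    using edge_profile_half_rises[OF f] by (simp_all add: u_def v_def linepath_0' linepath_1')
  then have P: "P = 4 * u - v" and Q: "Q = 4 * v - u"
    by (simp_all add: field_simps)
  have r: "edge_ratio h p = (if u = 0 then \<infinity> else ereal (v / u))"
    by (simp add: edge_ratio_def u_def v_def Let_def)
  show "edge_ratio h p = ereal 4 \<longleftrightarrow> P = 0" "edge_ratio h p = ereal (1 / 4) \<longleftrightarrow> Q = 0"
    using PQ unfolding r P Q by (auto simp: field_simps)
  show "ereal (1 / 4) \<le> edge_ratio h p \<and> edge_ratio h p \<le> ereal 4 \<longleftrightarrow> 0 \<le> P * Q"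
  proof (cases "u = 0")
    case True
    then have "v \<noteq> 0" using PQ unfolding P Q by auto
    then show ?thesis
      using True not_square_less_zero[of v] by (simp add: r P Q not_le order.strict_iff_order)
  next
    case False
    have "P * Q = u\<^sup>2 * ((4 - v / u) * (4 * (v / u) - 1))"
      using False unfolding P Q by (simp add: field_simps power2_eq_square)
    then have "0 \<le> P * Q \<longleftrightarrow> 0 \<le> (4 - v / u) * (4 * (v / u) - 1)"
      using False by (simp add: zero_le_mult_iff)
    also have "\<dots> \<longleftrightarrow> 1 / 4 \<le> v / u \<and> v / u \<le> 4"
      unfolding zero_le_mult_iff by linarith
    finally show ?thesis
      using False by (simp add: r)
  qed
qed

theorem theorem1p2:
  fixes q p :: "nat \<Rightarrow> real^2" and h :: "real^2 \<Rightarrow> real" and m :: nat and E :: "(real^2) set"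
  assumes "equilateral q"
    and "harmonic q h"
    and "\<not> h constant_on SG q"
    and "is_edge q m E"
    and "E = closed_segment (p 0) (p 1)"
  shows "(ereal (1/4) \<le> edge_ratio h p \<and> edge_ratio h p \<le> ereal 4 \<longrightarrow>
            strictly_monotone_on_edge h p)
       \<and> (\<not> (ereal (1/4) \<le> edge_ratio h p \<and> edge_ratio h p \<le> ereal 4) \<longrightarrow>
            (\<exists>!x. x \<in> E - {p 0, p 1} \<and> local_extremum_on E h x))
       \<and> convergent (alpha_quotient h p)
       \<and> (edge_ratio h p = ereal 4 \<longrightarrow> edge_alpha h p = 0)
       \<and> (edge_ratio h p \<noteq> ereal 4 \<longrightarrow> edge_alpha h p = \<infinity>)
       \<and> convergent (beta_quotient h p)
       \<and> (edge_ratio h p = ereal (1/4) \<longrightarrow> edge_beta h p = 0)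
       \<and> (edge_ratio h p \<noteq> ereal (1/4) \<longrightarrow> edge_beta h p = \<infinity>)"
proof -
  let ?L = "linepath (p 0) (p 1)"
  obtain P Q where f: "edge_profile (h \<circ> ?L) P Q" and PQ: "P \<noteq> 0 \<or> Q \<noteq> 0" and ne: "p 0 \<noteq> p 1"
    using harmonic_edge[OF assms(1-3)] assms(4,5) by metis
  note ratio = edge_ratio_slopes[OF f PQ]
  have fm: "edge_profile ((\<lambda>x. - h x) \<circ> ?L) (- P) (- Q)"
    using edge_profile_uminus[OF f] by (simp add: o_def)
  have mono: "strictly_monotone_on_edge h p" if "0 \<le> P * Q"
  proof (cases "P \<ge> 0 \<and> Q \<ge> 0")
    case True
    then show ?thesis
      using edge_profile_strict_mono[OF f] PQ unfolding strictly_monotone_on_edge_def by linarith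
  next
    case False
    then have "P \<le> 0" "Q \<le> 0"
      using that by (auto simp: zero_le_mult_iff)
    then show ?thesis
      using edge_profile_strict_antimono[OF f] PQ unfolding strictly_monotone_on_edge_def by linarith
  qed
  have ext: "\<exists>!x. x \<in> E - {p 0, p 1} \<and> local_extremum_on E h x" if "P * Q < 0"
  proof (cases "P > 0")
    case True
    then have "Q < 0"
      using that by (simp add: mult_less_0_iff)
    with True show ?thesis
      unfolding assms(5) by (metis edge_profile_peak[OF f] peak_unique_local_extremum[OF _ _ ne])
  next
    case False
    then have "- P > 0" "- Q < 0"
      using that by (auto simp: mult_less_0_iff)
    then have "\<exists>!x. x \<in> E - {p 0, p 1} \<and> local_extremum_on E (\<lambda>x. - h x) x"
      unfolding assms(5) by (metis edge_profile_peak[OF fm] peak_unique_local_extremum[OF _ _ ne])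
    then show ?thesis
      by (simp only: local_extremum_on_uminus)
  qed
  note alpha = alpha_quotient_limit[OF f ne]
  have "edge_profile (h \<circ> linepath (p (1 - 0)) (p (1 - 1))) (- Q) (- P)"
    using edge_profile_reverse[OF f] by (simp add: o_def linepath_def algebra_simps)
  from alpha_quotient_limit[OF this[folded One_nat_def]] ne
  have beta: "Q = 0 \<Longrightarrow> beta_quotient h p \<longlonglongrightarrow> 0" "Q \<noteq> 0 \<Longrightarrow> beta_quotient h p \<longlonglongrightarrow> \<infinity>"
    by (auto simp: beta_quotient_eq_alpha_quotient)
  have "convergent (alpha_quotient h p)" "convergent (beta_quotient h p)"
    using alpha beta by (metis convergentI)+
  then show ?thesis
    using mono ext limI[OF alpha(1)] limI[OF alpha(2)] limI[OF beta(1)] limI[OF beta(2)]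
    unfolding ratio edge_alpha_def edge_beta_def by (simp add: not_le)
qed

end
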